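(* Consider binary-valued output processes $\{l^{(1)}(t)\in\{0,1\}\}_{t\in\mathbb{N}_0}$ and $\{l^{(2)}(t)\in\{0,1\}\}_{t\in\mathbb{N}_0}$ of time-inhomogeneous hidden Markov models such that $l^{(1)}\in\Gamma_{p_0^{(1)},p_1^{(1)}}$ and $l^{(2)}\in\Gamma_{p_0^{(2)},p_1^{(2)}}$ with $p_0^{(1)},p_1^{(1)},p_0^{(2)},p_1^{(2)}\in[0,1]$. Suppose that the Markov chains $\{\theta^{l^{(1)}}(t)\in\Theta^{l^{(1)}}\}_{t\in\mathbb{N}_0}$ and $\{\theta^{l^{(2)}}(t)\in\Theta^{l^{(2)}}\}_{t\in\mathbb{N}_0}$ associated with $l^{(1)}$ and $l^{(2)}$ are mutually independent. Let $$\tilde p_0\triangleq\min\{p_0^{(1)}+p_1^{(1)}p_0^{(2)},\;p_0^{(2)}+p_1^{(2)}p_0^{(1)},\;1\},\qquad \tilde p_1\triangleq p_1^{(1)}p_1^{(2)}.$$ Then the process $\{\tilde l(t)\in\{0,1\}\}_{t\in\mathbb{N}_0}$ defined by $\tilde l(t)=l^{(1)}(t)\wedge l^{(2)}(t)$, $t\in\mathbb{N}_0$, is the output process of a time-inhomogeneous hidden Markov model, and moreover $\tilde l\in\Gamma_{\tilde p_0,\tilde p_1}$.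
   Context: All processes are defined on a common probability space $(\Omega,\mathcal{F},\mathbb{P})$ with filtration $\{\mathcal{F}_t\}_{t\in\mathbb{N}_0}$. $\wedge$ denotes the and-operation on binary numbers. Hidden Markov models: a binary-valued process $\{l(t)\in\{0,1\}\}_{t\in\mathbb{N}_0}$ is the output process of a time-inhomogeneous hidden Markov model if $l(t)=h^l(\theta^l(t))$, $t\in\mathbb{N}_0$, where $h^l\colon\Theta^l\to\{0,1\}$ is a function on a finite set $\Theta^l$ and $\{\theta^l(t)\in\Theta^l\}_{t\in\mathbb{N}_0}$ is an $\mathcal{F}_t$-adapted, finite-state, time-inhomogeneous Markov chain with initial distribution $\vartheta^l_q\in[0,1]$, $q\in\Theta^l$, and time-varying transition probability functions $p^l_{q,r}\colon\mathbb{N}_0\to[0,1]$, $q,r\in\Theta^l$ (so $\sum_{r\in\Theta^l}p^l_{q,r}(t)=1$), satisfying $\mathbb{P}[\theta^l(0)=q]=\vartheta^l_q$ and $\mathbb{P}[\theta^l(t+1)=r\mid\theta^l(t)=q]=p^l_{q,r}(t)$. Put $\Theta^l_0\triangleq\{r\in\Theta^l\colon h^l(r)=0\}$ and $\Theta^l_1\triangleq\{r\in\Theta^l\colon h^l(r)=1\}$. Class $\Gamma_{p_0,p_1}$: for $p_0,p_1\in[0,1]$, $\Gamma_{p_0,p_1}$ is the class of output processes $l$ of time-inhomogeneous hidden Markov models such that $\sum_{r\in\Theta^l_0}p^l_{q,r}(t)\le p_0$ and $\sum_{r\in\Theta^l_1}p^l_{q,r}(t)\le p_1$ for all $q\in\Theta^l$,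 $t\in\mathbb{N}_0$. *)

theory Defs
  imports "HOL-Probability.Probability" "HOL-Library.Z2"
begin

unbundle bit_operations_syntax

text \<open>
  A time-inhomogeneous Markov chain \<^term>\<open>\<theta>\<close> with finite state set \<^term>\<open>\<Theta>\<close>, adapted to the
  filtration \<^term>\<open>F\<close>; \<^term>\<open>p q r t\<close> is the probability of moving from \<^term>\<open>q\<close> to \<^term>\<open>r\<close>
  between the times \<^term>\<open>t\<close> and \<^term>\<open>Suc t\<close>. The Markov property is the elementary one, with
  respect to the past of the chain itself and not with respect to \<^term>\<open>F\<close>. Conditional
  probabilities are constrained only where the conditioning event has positive probability, as
  they are \<^term>\<open>0::real\<close> by convention otherwise; on the other hand, the transition probability
  functions are stochastic at every state, reachable or not.
\<close>

definition markov_chain ::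
  "'w measure \<Rightarrow> (nat \<Rightarrow> 'w measure) \<Rightarrow> 's set \<Rightarrow> ('s \<Rightarrow> real) \<Rightarrow> ('s \<Rightarrow> 's \<Rightarrow> nat \<Rightarrow> real) \<Rightarrow>
    (nat \<Rightarrow> 'w \<Rightarrow> 's) \<Rightarrow> bool"
where
  "markov_chain M F \<Theta> \<nu> p \<theta> \<longleftrightarrow>
     finite \<Theta> \<and>
     (\<forall>t. \<theta> t \<in> measurable (F t) (count_space \<Theta>)) \<and>
     (\<forall>q\<in>\<Theta>. \<nu> q \<in> {0..1}) \<and>
     (\<forall>q\<in>\<Theta>. \<forall>r\<in>\<Theta>. \<forall>t. p q r t \<in> {0..1}) \<and>
     (\<forall>q\<in>\<Theta>. \<forall>t. (\<Sum>r\<in>\<Theta>. p q r t) = 1) \<and>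
     (\<forall>q\<in>\<Theta>. \<P>(\<omega> in M. \<theta> 0 \<omega> = q) = \<nu> q) \<and>
     (\<forall>t. \<forall>q\<in>\<Theta>. \<forall>r\<in>\<Theta>. \<P>(\<omega> in M. \<theta> t \<omega> = q) > 0 \<longrightarrow>
        \<P>(\<omega> in M. \<theta> (Suc t) \<omega> = r \<bar> \<theta> t \<omega> = q) = p q r t) \<and>
     (\<forall>t x. \<forall>r\<in>\<Theta>. \<P>(\<omega> in M. \<forall>i\<le>t. \<theta> i \<omega> = x i) > 0 \<longrightarrow>
        \<P>(\<omega> in M. \<theta> (Suc t) \<omega> = r \<bar> \<forall>i\<le>t. \<theta> i \<omega> = x i) =
        \<P>(\<omega> in M. \<theta> (Suc t) \<omega> = r \<bar> \<theta> t \<omega> = x t))"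

definition hidden_markov_model ::
  "'w measure \<Rightarrow> (nat \<Rightarrow> 'w measure) \<Rightarrow> 's set \<Rightarrow> ('s \<Rightarrow> real) \<Rightarrow> ('s \<Rightarrow> 's \<Rightarrow> nat \<Rightarrow> real) \<Rightarrow>
    (nat \<Rightarrow> 'w \<Rightarrow> 's) \<Rightarrow> ('s \<Rightarrow> bit) \<Rightarrow> (nat \<Rightarrow> 'w \<Rightarrow> bit) \<Rightarrow> bool"
where
  "hidden_markov_model M F \<Theta> \<nu> p \<theta> h l \<longleftrightarrow>
     markov_chain M F \<Theta> \<nu> p \<theta> \<and> (\<forall>t. \<forall>\<omega>\<in>space M. l t \<omega> = h (\<theta> t \<omega>))"

definition transition_bounds ::
  "'s set \<Rightarrow> ('s \<Rightarrow> 's \<Rightarrow> nat \<Rightarrow> real) \<Rightarrow> ('s \<Rightarrow> bit) \<Rightarrow> real \<Rightarrow> real \<Rightarrow> bool"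
where
  "transition_bounds \<Theta> p h p0 p1 \<longleftrightarrow>
     (\<forall>q\<in>\<Theta>. \<forall>t. (\<Sum>r\<in>{r\<in>\<Theta>. h r = 0}. p q r t) \<le> p0 \<and> (\<Sum>r\<in>{r\<in>\<Theta>. h r = 1}. p q r t) \<le> p1)"

text \<open>
  The existential quantifiers below range over state sets of natural numbers, because a definition
  cannot quantify over the type of the states. As state sets are finite, this is no restriction:
  see the lemmas \<open>hmm_output_processI\<close> and \<open>hmm_classI\<close>.
\<close>

definition hmm_output_process ::
  "'w measure \<Rightarrow> (nat \<Rightarrow> 'w measure) \<Rightarrow> (nat \<Rightarrow> 'w \<Rightarrow> bit) \<Rightarrow> bool"
where
  "hmm_output_process M F l \<longleftrightarrow>
     (\<exists>(\<Theta>::nat set) \<nu> p \<theta> h. hidden_markov_model M F \<Theta> \<nu> p \<theta> h l)"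

text \<open>The class \<open>\<Gamma>\<close> with parameters \<^term>\<open>p0\<close> and \<^term>\<open>p1\<close>.\<close>

definition hmm_class ::
  "'w measure \<Rightarrow> (nat \<Rightarrow> 'w measure) \<Rightarrow> real \<Rightarrow> real \<Rightarrow> (nat \<Rightarrow> 'w \<Rightarrow> bit) set"
where
  "hmm_class M F p0 p1 =
     {l. \<exists>(\<Theta>::nat set) \<nu> p \<theta> h.
           hidden_markov_model M F \<Theta> \<nu> p \<theta> h l \<and> transition_bounds \<Theta> p h p0 p1}"

text \<open>The \<open>\<sigma>\<close>-algebra generated by all the variables of a process with discrete state space.\<close>

definition process_sigma :: "'w measure \<Rightarrow> (nat \<Rightarrow> 'w \<Rightarrow> 's) \<Rightarrow> 'w set set" where
  "process_sigma M \<theta> = sigma_sets (space M) {\<theta> t -` A \<inter> space M | t A. True}"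

text \<open>
  The constant \<^const>\<open>prob_space.indep_var\<close> would require both chains to have the same type of states.
\<close>

definition indep_processes ::
  "'w measure \<Rightarrow> (nat \<Rightarrow> 'w \<Rightarrow> 's) \<Rightarrow> (nat \<Rightarrow> 'w \<Rightarrow> 'u) \<Rightarrow> bool"
where
  "indep_processes M \<theta> \<eta> \<longleftrightarrow> prob_space.indep_set M (process_sigma M \<theta>) (process_sigma M \<eta>)"

lemma markov_chain_relabel:
  fixes f :: "'s \<Rightarrow> 'u"
  assumes mc: "markov_chain M F \<Theta> \<nu> p \<theta>" and inj: "inj_on f \<Theta>"
    and sp: "\<And>t. space (F t) = space M"
  defines "g \<equiv> inv_into \<Theta> f"
  shows "markov_chain M F (f ` \<Theta>) (\<lambda>a. \<nu> (g a)) (\<lambda>a b. p (g a) (g b)) (\<lambda>t \<omega>. f (\<theta> t \<omega>))"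
proof -
  have meas: "\<theta> t \<in> measurable (F t) (count_space \<Theta>)" for t
    using mc by (auto simp: markov_chain_def)
  have in_state: "\<theta> t \<omega> \<in> \<Theta>" if "\<omega> \<in> space M" for t \<omega>
    using measurable_space[OF meas, of \<omega> t] that sp by auto
  have gf [simp]: "g (f q) = q" if "q \<in> \<Theta>" for q
    using that inj by (simp add: g_def)
  have eq_iff: "f (\<theta> t \<omega>) = f q \<longleftrightarrow> \<theta> t \<omega> = q" if "\<omega> \<in> space M" "q \<in> \<Theta>" for t \<omega> q
    using that in_state[of \<omega> t] inj by (auto dest: inj_onD)
  have one: "{\<omega> \<in> space M. f (\<theta> t \<omega>) = f q} = {\<omega> \<in> space M. \<theta> t \<omega> = q}" if "q \<in> \<Theta>" for t q
    using that eq_iff by auto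
  have two: "{\<omega> \<in> space M. f (\<theta> s \<omega>) = f r \<and> f (\<theta> t \<omega>) = f q} =
      {\<omega> \<in> space M. \<theta> s \<omega> = r \<and> \<theta> t \<omega> = q}" if "q \<in> \<Theta>" "r \<in> \<Theta>" for s t q r
    using that eq_iff by auto
  have markov: "\<P>(\<omega> in M. f (\<theta> (Suc t) \<omega>) = f r \<bar> \<forall>i\<le>t. f (\<theta> i \<omega>) = x i) =
        \<P>(\<omega> in M. f (\<theta> (Suc t) \<omega>) = f r \<bar> f (\<theta> t \<omega>) = x t)"
    if r: "r \<in> \<Theta>" and pos: "\<P>(\<omega> in M. \<forall>i\<le>t. f (\<theta> i \<omega>) = x i) > 0" for t x r
  proof -
    have "{\<omega> \<in> space M. \<forall>i\<le>t. f (\<theta> i \<omega>) = x i} \<noteq> {}"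
      using pos by (metis measure_empty less_irrefl)
    then obtain \<omega>0 where w0: "\<omega>0 \<in> space M" "\<forall>i\<le>t. f (\<theta> i \<omega>0) = x i"
      by auto
    define y where "y i = \<theta> i \<omega>0" for i
    have y: "y i \<in> \<Theta>" for i
      using in_state w0(1) by (simp add: y_def)
    have x: "x i = f (y i)" if "i \<le> t" for i
      using w0(2) that by (simp add: y_def)
    have hist: "(\<forall>i\<le>t. f (\<theta> i \<omega>) = x i) \<longleftrightarrow> (\<forall>i\<le>t. \<theta> i \<omega> = y i)" if "\<omega> \<in> space M" for \<omega>
      using that x y eq_iff by auto
    have hist_set: "{\<omega> \<in> space M. \<forall>i\<le>t. f (\<theta> i \<omega>) = x i} = {\<omega> \<in> space M. \<forall>i\<le>t. \<theta> i \<omega> = y i}"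
      using hist by auto
    have hist_next: "{\<omega> \<in> space M. f (\<theta> (Suc t) \<omega>) = f r \<and> (\<forall>i\<le>t. f (\<theta> i \<omega>) = x i)} =
        {\<omega> \<in> space M. \<theta> (Suc t) \<omega> = r \<and> (\<forall>i\<le>t. \<theta> i \<omega> = y i)}"
      using hist eq_iff r by blast
    have "\<P>(\<omega> in M. \<theta> (Suc t) \<omega> = r \<bar> \<forall>i\<le>t. \<theta> i \<omega> = y i) =
        \<P>(\<omega> in M. \<theta> (Suc t) \<omega> = r \<bar> \<theta> t \<omega> = y t)"
      using mc r pos hist_set by (auto simp: markov_chain_def)
    then show ?thesis
      using x[of t] by (simp add: cond_prob_def hist_set hist_next two one r y)
  qed
  have "f \<in> count_space \<Theta> \<rightarrow>\<^sub>M count_space (f ` \<Theta>)"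
    by auto
  then have "(\<lambda>\<omega>. f (\<theta> t \<omega>)) \<in> measurable (F t) (count_space (f ` \<Theta>))" for t
    using measurable_compose[OF meas] by blast
  moreover have "(\<Sum>b\<in>f ` \<Theta>. p q (g b) t) = (\<Sum>r\<in>\<Theta>. p q r t)" for q t
    using inj by (simp add: sum.reindex)
  ultimately show ?thesis
    using mc markov unfolding markov_chain_def
    by (auto simp: cond_prob_def one two)
qed

lemma transition_bounds_relabel:
  assumes "transition_bounds \<Theta> p h p0 p1" and inj: "inj_on f \<Theta>"
  defines "g \<equiv> inv_into \<Theta> f"
  shows "transition_bounds (f ` \<Theta>) (\<lambda>a b. p (g a) (g b)) (\<lambda>a. h (g a)) p0 p1"
proof -
  have gf: "g (f q) = q" if "q \<in> \<Theta>" for q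
    using that inj by (simp add: g_def)
  have "(\<Sum>b\<in>{b \<in> f ` \<Theta>. h (g b) = c}. p q (g b) t) = (\<Sum>r\<in>{r \<in> \<Theta>. h r = c}. p q r t)" for c q t
  proof -
    have "{b \<in> f ` \<Theta>. h (g b) = c} = f ` {r \<in> \<Theta>. h r = c}"
      using gf by auto
    moreover have "inj_on f {r \<in> \<Theta>. h r = c}"
      using inj by (rule inj_on_subset) auto
    ultimately show ?thesis
      by (simp add: sum.reindex gf)
  qed
  then show ?thesis
    using assms(1) by (auto simp: transition_bounds_def gf)
qed

lemma hidden_markov_model_relabel:
  assumes "hidden_markov_model M F \<Theta> \<nu> p \<theta> h l" and inj: "inj_on f \<Theta>"
    and sp: "\<And>t. space (F t) = space M"
  defines "g \<equiv> inv_into \<Theta> f"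
  shows "hidden_markov_model M F (f ` \<Theta>) (\<lambda>a. \<nu> (g a)) (\<lambda>a b. p (g a) (g b))
    (\<lambda>t \<omega>. f (\<theta> t \<omega>)) (\<lambda>a. h (g a)) l"
proof -
  have mc: "markov_chain M F \<Theta> \<nu> p \<theta>"
    using assms(1) by (simp add: hidden_markov_model_def)
  have "\<theta> t \<omega> \<in> \<Theta>" if "\<omega> \<in> space M" for t \<omega>
  proof -
    have "\<theta> t \<in> measurable (F t) (count_space \<Theta>)"
      using mc by (simp add: markov_chain_def)
    from measurable_space[OF this, of \<omega>] show ?thesis
      using that sp by simp
  qed
  then show ?thesis
    using assms(1) markov_chain_relabel[OF mc inj sp] inj
    by (auto simp: hidden_markov_model_def g_def)
qed

lemma hmm_output_processI:
  assumes hmm: "hidden_markov_model M F \<Theta> \<nu> p \<theta> h l"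
    and sp: "\<And>t. space (F t) = space M"
  shows "hmm_output_process M F l"
proof -
  have "finite \<Theta>"
    using hmm by (simp add: hidden_markov_model_def markov_chain_def)
  then obtain f :: "_ \<Rightarrow> nat" where "inj_on f \<Theta>"
    by (metis finite_imp_inj_to_nat_seg)
  from hidden_markov_model_relabel[OF hmm this sp] show ?thesis
    unfolding hmm_output_process_def by blast
qed

lemma hmm_classI:
  assumes hmm: "hidden_markov_model M F \<Theta> \<nu> p \<theta> h l"
    and bounds: "transition_bounds \<Theta> p h p0 p1"
    and sp: "\<And>t. space (F t) = space M"
  shows "l \<in> hmm_class M F p0 p1"
proof -
  have "finite \<Theta>"
    using hmm by (simp add: hidden_markov_model_def markov_chain_def)
  then obtain f :: "_ \<Rightarrow> nat" where "inj_on f \<Theta>"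
    by (metis finite_imp_inj_to_nat_seg)
  from hidden_markov_model_relabel[OF hmm this sp] transition_bounds_relabel[OF bounds this]
  show ?thesis
    unfolding hmm_class_def by blast
qed

end

theory Submission
  imports Defs
begin

text \<open>
  The pair \<open>(\<theta>1, \<theta>2)\<close> is a Markov chain on \<open>\<Theta>1 \<times> \<Theta>2\<close> whose transition probabilities are the products
  of those of the two chains, because by independence a conditional probability of a product event
  given a product event factorises. The conjunction of the outputs is a function of this chain. It
  takes the value 1 on \<open>{h1 = 1} \<times> {h2 = 1}\<close>, and the value 0 on the disjoint union of
  \<open>{h1 = 0} \<times> \<Theta>2\<close> and \<open>{h1 = 1} \<times> {h2 = 0}\<close>, or symmetrically with the roles of the two chains
  exchanged; this gives the two bounds other than 1 in the minimum.
\<close>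

lemma bit_and_eq_0_iff: "a AND b = 0 \<longleftrightarrow> a = 0 \<or> b = 0" for a b :: bit
  by (cases a; cases b) simp_all

lemma bit_and_eq_1_iff: "a AND b = 1 \<longleftrightarrow> a = 1 \<and> b = 1" for a b :: bit
  by (cases a; cases b) simp_all

lemma process_sigma_Collect:
  "{\<omega> \<in> space M. \<theta> t \<omega> = q} \<in> process_sigma M \<theta>"
proof -
  have "{\<omega> \<in> space M. \<theta> t \<omega> = q} = \<theta> t -` {q} \<inter> space M"
    by auto
  then show ?thesis
    unfolding process_sigma_def by (blast intro: sigma_sets.Basic)
qed

lemma sigma_algebra_process_sigma: "sigma_algebra (space M) (process_sigma M \<theta>)"
  unfolding process_sigma_def by (rule sigma_algebra_sigma_sets) auto

text \<open>A history is a finite intersection of events at single times. This brings the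
  conditioning events of the Markov property within reach of independence.\<close>

lemma process_sigma_history:
  "{\<omega> \<in> space M. \<forall>i\<le>t. \<theta> i \<omega> = x i} \<in> process_sigma M \<theta>" (is "?A \<in> _")
proof -
  interpret sigma_algebra "space M" "process_sigma M \<theta>"
    by (rule sigma_algebra_process_sigma)
  have "?A = (\<Inter>i\<in>{..t}. {\<omega> \<in> space M. \<theta> i \<omega> = x i})"
    by auto
  also have "\<dots> \<in> process_sigma M \<theta>"
    by (rule finite_INT) (auto intro: process_sigma_Collect)
  finally show ?thesis .
qed

lemma (in prob_space) indep_set_prob_conj:
  assumes "indep_set S T" "{\<omega> \<in> space M. A \<omega>} \<in> S" "{\<omega> \<in> space M. B \<omega>} \<in> T"
  shows "\<P>(\<omega> in M. A \<omega> \<and> B \<omega>) = \<P>(\<omega> in M. A \<omega>) * \<P>(\<omega> in M. B \<omega>)"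
proof -
  have "{\<omega> \<in> space M. A \<omega> \<and> B \<omega>} = {\<omega> \<in> space M. A \<omega>} \<inter> {\<omega> \<in> space M. B \<omega>}"
    by auto
  then show ?thesis
    using indep_setD[OF assms] by simp
qed

text \<open>Independence factorises the numerator and the denominator of the quotient separately.
  Conditioning on a null event causes no exception: division by zero gives 0, so both sides are then
  0.\<close>

lemma (in prob_space) indep_processes_cond_prob:
  assumes "indep_processes M \<theta> \<eta>"
    and E: "{\<omega> \<in> space M. E \<omega>} \<in> process_sigma M \<theta>" and A: "{\<omega> \<in> space M. A \<omega>} \<in> process_sigma M \<theta>"
    and G: "{\<omega> \<in> space M. G \<omega>} \<in> process_sigma M \<eta>" and B: "{\<omega> \<in> space M. B \<omega>} \<in> process_sigma M \<eta>"
  shows "\<P>(\<omega> in M. E \<omega> \<and> G \<omega> \<bar> A \<omega> \<and> B \<omega>) = \<P>(\<omega> in M. E \<omega> \<bar> A \<omega>) * \<P>(\<omega> in M. G \<omega> \<bar> B \<omega>)"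
proof -
  interpret S: sigma_algebra "space M" "process_sigma M \<theta>"
    by (rule sigma_algebra_process_sigma)
  interpret T: sigma_algebra "space M" "process_sigma M \<eta>"
    by (rule sigma_algebra_process_sigma)
  have ind: "indep_set (process_sigma M \<theta>) (process_sigma M \<eta>)"
    using assms(1) by (simp add: indep_processes_def)
  have EA: "{\<omega> \<in> space M. E \<omega> \<and> A \<omega>} \<in> process_sigma M \<theta>"
    using A E by (rule S.sets_Collect_conj)
  have GB: "{\<omega> \<in> space M. G \<omega> \<and> B \<omega>} \<in> process_sigma M \<eta>"
    using B G by (rule T.sets_Collect_conj)
  \<comment> \<open>Regrouping by process turns the numerator into an event of
    \<open>\<theta>\<close> and an event of \<open>\<eta>\<close>.\<close>
  have "{\<omega> \<in> space M. (E \<omega> \<and> G \<omega>) \<and> A \<omega> \<and> B \<omega>} = {\<omega> \<in> space M. (E \<omega> \<and> A \<omega>) \<and> G \<omega> \<and> B \<omega>}"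
    by auto
  then show ?thesis
    using indep_set_prob_conj[OF ind EA GB] indep_set_prob_conj[OF ind A B]
    by (simp add: cond_prob_def)
qed

text \<open>The Markov property refers to the past of the chain itself, whose events lie in
  \<open>process_sigma\<close>. Hence independence splits the conditional probabilities given the
  present and given the whole past alike, and the two agree factor by factor.\<close>

lemma (in prob_space) markov_chain_Pair:
  assumes mc1: "markov_chain M F \<Theta>1 \<nu>1 P1 \<theta>1" and mc2: "markov_chain M F \<Theta>2 \<nu>2 P2 \<theta>2"
    and indep: "indep_processes M \<theta>1 \<theta>2"
  shows "markov_chain M F (\<Theta>1 \<times> \<Theta>2) (\<lambda>(a, b). \<nu>1 a * \<nu>2 b)
    (\<lambda>(a, b) (c, d) t. P1 a c t * P2 b d t) (\<lambda>t \<omega>. (\<theta>1 t \<omega>, \<theta>2 t \<omega>))"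
proof -
  note m1 = mc1[unfolded markov_chain_def] and m2 = mc2[unfolded markov_chain_def]
  have fin: "finite \<Theta>1" "finite \<Theta>2"
    using m1 m2 by auto
  have ind: "indep_set (process_sigma M \<theta>1) (process_sigma M \<theta>2)"
    using indep by (simp add: indep_processes_def)
  note at1 = process_sigma_Collect[of M \<theta>1] and at2 = process_sigma_Collect[of M \<theta>2]
  note hist1 = process_sigma_history[of M _ \<theta>1] and hist2 = process_sigma_history[of M _ \<theta>2]
  have meas: "(\<lambda>\<omega>. (\<theta>1 t \<omega>, \<theta>2 t \<omega>)) \<in> F t \<rightarrow>\<^sub>M count_space (\<Theta>1 \<times> \<Theta>2)" for t
  proof -
    have "\<theta>1 t \<in> F t \<rightarrow>\<^sub>M count_space \<Theta>1" "\<theta>2 t \<in> F t \<rightarrow>\<^sub>M count_space \<Theta>2"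
      using m1 m2 by auto
    then have "(\<lambda>\<omega>. (\<theta>1 t \<omega>, \<theta>2 t \<omega>)) \<in> F t \<rightarrow>\<^sub>M count_space \<Theta>1 \<Otimes>\<^sub>M count_space \<Theta>2"
      by (rule measurable_Pair)
    \<comment> \<open>Since the state sets are finite, the product of the two discrete measurable
      spaces is again discrete.\<close>
    then show ?thesis
      by (simp add: pair_measure_count_space fin)
  qed
  have total: "(\<Sum>(c, d)\<in>\<Theta>1 \<times> \<Theta>2. P1 a c t * P2 b d t) = 1" if "a \<in> \<Theta>1" "b \<in> \<Theta>2" for a b t
    using that m1 m2 by (simp flip: sum.cartesian_product sum_distrib_left)
  have cond: "\<P>(\<omega> in M. \<theta>1 (Suc t) \<omega> = c \<and> \<theta>2 (Suc t) \<omega> = d \<bar> \<theta>1 t \<omega> = a \<and> \<theta>2 t \<omega> = b) =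
      \<P>(\<omega> in M. \<theta>1 (Suc t) \<omega> = c \<bar> \<theta>1 t \<omega> = a) * \<P>(\<omega> in M. \<theta>2 (Suc t) \<omega> = d \<bar> \<theta>2 t \<omega> = b)"
    for a b c d t
    by (rule indep_processes_cond_prob[OF indep at1 at1 at2 at2])
  have step: "\<P>(\<omega> in M. \<theta>1 (Suc t) \<omega> = c \<and> \<theta>2 (Suc t) \<omega> = d \<bar> \<theta>1 t \<omega> = a \<and> \<theta>2 t \<omega> = b) =
      P1 a c t * P2 b d t"
    if "a \<in> \<Theta>1" "c \<in> \<Theta>1" "b \<in> \<Theta>2" "d \<in> \<Theta>2"
      and pos: "\<P>(\<omega> in M. \<theta>1 t \<omega> = a \<and> \<theta>2 t \<omega> = b) > 0" for a b c d t
  proof -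
    \<comment> \<open>The transition probabilities of each chain are prescribed only at states of
      positive probability. A positive product of two nonnegative probabilities has both factors
      positive.\<close>
    have "\<P>(\<omega> in M. \<theta>1 t \<omega> = a) > 0" "\<P>(\<omega> in M. \<theta>2 t \<omega> = b) > 0"
      using pos indep_set_prob_conj[OF ind at1 at2, of t a t b]
      by (auto simp: zero_less_mult_iff not_less measure_nonneg dest: leD)
    then show ?thesis
      using that m1 m2 by (simp add: cond)
  qed
  have past1: "\<P>(\<omega> in M. \<theta>1 (Suc t) \<omega> = r \<bar> \<forall>i\<le>t. \<theta>1 i \<omega> = y i) =
      \<P>(\<omega> in M. \<theta>1 (Suc t) \<omega> = r \<bar> \<theta>1 t \<omega> = y t)"
    if "r \<in> \<Theta>1" "\<P>(\<omega> in M. \<forall>i\<le>t. \<theta>1 i \<omega> = y i) > 0" for r t y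
    using that m1 by blast
  have past2: "\<P>(\<omega> in M. \<theta>2 (Suc t) \<omega> = r \<bar> \<forall>i\<le>t. \<theta>2 i \<omega> = y i) =
      \<P>(\<omega> in M. \<theta>2 (Suc t) \<omega> = r \<bar> \<theta>2 t \<omega> = y t)"
    if "r \<in> \<Theta>2" "\<P>(\<omega> in M. \<forall>i\<le>t. \<theta>2 i \<omega> = y i) > 0" for r t y
    using that m2 by blast
  have markov: "\<P>(\<omega> in M. (\<theta>1 (Suc t) \<omega>, \<theta>2 (Suc t) \<omega>) = (c, d) \<bar>
        \<forall>i\<le>t. (\<theta>1 i \<omega>, \<theta>2 i \<omega>) = x i) =
      \<P>(\<omega> in M. (\<theta>1 (Suc t) \<omega>, \<theta>2 (Suc t) \<omega>) = (c, d) \<bar> (\<theta>1 t \<omega>, \<theta>2 t \<omega>) = x t)"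
    if "c \<in> \<Theta>1" "d \<in> \<Theta>2" and pos: "\<P>(\<omega> in M. \<forall>i\<le>t. (\<theta>1 i \<omega>, \<theta>2 i \<omega>) = x i) > 0" for c d t x
  proof -
    \<comment> \<open>A path of the pair is prescribed by prescribing its two coordinate paths, so
      its history is a conjunction of one event per chain.\<close>
    have hist: "(\<forall>i\<le>t. (\<theta>1 i \<omega>, \<theta>2 i \<omega>) = x i) \<longleftrightarrow>
        (\<forall>i\<le>t. \<theta>1 i \<omega> = fst (x i)) \<and> (\<forall>i\<le>t. \<theta>2 i \<omega> = snd (x i))" for \<omega>
      by (auto simp: prod_eq_iff)
    have "\<P>(\<omega> in M. \<forall>i\<le>t. \<theta>1 i \<omega> = fst (x i)) > 0" "\<P>(\<omega> in M. \<forall>i\<le>t. \<theta>2 i \<omega> = snd (x i)) > 0"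
      using pos indep_set_prob_conj[OF ind hist1 hist2, of t "\<lambda>i. fst (x i)" t "\<lambda>i. snd (x i)"]
      unfolding hist by (auto simp: zero_less_mult_iff not_less measure_nonneg dest: leD)
    note past = past1[OF that(1) this(1)] past2[OF that(2) this(2)]
    \<comment> \<open>The left side splits with the histories as conditions, the right side splits
      by \<open>cond\<close>; \<open>past\<close> identifies the corresponding factors.\<close>
    show ?thesis
      unfolding hist using past indep_processes_cond_prob[OF indep at1 hist1 at2 hist2]
      by (simp add: cond prod_eq_iff)
  qed
  show ?thesis
    unfolding markov_chain_def
  proof (intro conjI allI ballI impI)
    fix q t assume "q \<in> \<Theta>1 \<times> \<Theta>2"
    then show "(\<Sum>r\<in>\<Theta>1 \<times> \<Theta>2. (case q of (a, b) \<Rightarrow> \<lambda>(c, d) t. P1 a c t * P2 b d t) r t) = 1"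
      using total by (auto simp: case_prod_unfold)
  next
    fix q assume "q \<in> \<Theta>1 \<times> \<Theta>2"
    then show "\<P>(\<omega> in M. (\<theta>1 0 \<omega>, \<theta>2 0 \<omega>) = q) = (case q of (a, b) \<Rightarrow> \<nu>1 a * \<nu>2 b)"
      using m1 m2 indep_set_prob_conj[OF ind at1 at2] by auto
  next
    fix t q r assume "q \<in> \<Theta>1 \<times> \<Theta>2" "r \<in> \<Theta>1 \<times> \<Theta>2" "\<P>(\<omega> in M. (\<theta>1 t \<omega>, \<theta>2 t \<omega>) = q) > 0"
    then show "\<P>(\<omega> in M. (\<theta>1 (Suc t) \<omega>, \<theta>2 (Suc t) \<omega>) = r \<bar> (\<theta>1 t \<omega>, \<theta>2 t \<omega>) = q) =
        (case q of (a, b) \<Rightarrow> \<lambda>(c, d) t. P1 a c t * P2 b d t) r t"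
      using step by auto
  next
    fix t x r assume "r \<in> \<Theta>1 \<times> \<Theta>2" "\<P>(\<omega> in M. \<forall>i\<le>t. (\<theta>1 i \<omega>, \<theta>2 i \<omega>) = x i) > 0"
    then show "\<P>(\<omega> in M. (\<theta>1 (Suc t) \<omega>, \<theta>2 (Suc t) \<omega>) = r \<bar> \<forall>i\<le>t. (\<theta>1 i \<omega>, \<theta>2 i \<omega>) = x i) =
        \<P>(\<omega> in M. (\<theta>1 (Suc t) \<omega>, \<theta>2 (Suc t) \<omega>) = r \<bar> (\<theta>1 t \<omega>, \<theta>2 t \<omega>) = x t)"
      using markov by (cases r) blast
  qed (use fin meas m1 m2 in \<open>auto intro!: mult_nonneg_nonneg mult_le_one\<close>)
qed

lemma hidden_markov_model_and:
  assumes "prob_space M"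
    and "hidden_markov_model M F \<Theta>1 \<nu>1 P1 \<theta>1 h1 l1" and "hidden_markov_model M F \<Theta>2 \<nu>2 P2 \<theta>2 h2 l2"
    and "indep_processes M \<theta>1 \<theta>2"
  shows "hidden_markov_model M F (\<Theta>1 \<times> \<Theta>2) (\<lambda>(a, b). \<nu>1 a * \<nu>2 b)
    (\<lambda>(a, b) (c, d) t. P1 a c t * P2 b d t) (\<lambda>t \<omega>. (\<theta>1 t \<omega>, \<theta>2 t \<omega>))
    (\<lambda>(a, b). h1 a AND h2 b) (\<lambda>t \<omega>. l1 t \<omega> AND l2 t \<omega>)"
  using assms(2-) by (auto simp: hidden_markov_model_def intro: prob_space.markov_chain_Pair[OF assms(1)])

text \<open>Each row of the product transition matrix is a product of two rows, so both bounds
  reduce to arithmetic in four masses. The chain hypotheses supply finite state sets, nonnegative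
  entries and row sums 1.\<close>

lemma transition_bounds_and:
  fixes P1 :: "'a \<Rightarrow> 'a \<Rightarrow> nat \<Rightarrow> real" and P2 :: "'b \<Rightarrow> 'b \<Rightarrow> nat \<Rightarrow> real"
  assumes mc1: "markov_chain M F \<Theta>1 \<nu>1 P1 \<theta>1" and mc2: "markov_chain M F \<Theta>2 \<nu>2 P2 \<theta>2"
    and b1: "transition_bounds \<Theta>1 P1 h1 p0_1 p1_1" and b2: "transition_bounds \<Theta>2 P2 h2 p0_2 p1_2"
    and p1: "0 \<le> p1_1" "0 \<le> p1_2"
  shows "transition_bounds (\<Theta>1 \<times> \<Theta>2) (\<lambda>(a, b) (c, d) t. P1 a c t * P2 b d t)
    (\<lambda>(a, b). h1 a AND h2 b) (min (min (p0_1 + p1_1 * p0_2) (p0_2 + p1_2 * p0_1)) 1) (p1_1 * p1_2)"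
proof -
  define Z where "Z = {r \<in> \<Theta>1 \<times> \<Theta>2. (case r of (c, d) \<Rightarrow> h1 c AND h2 d) = 0}"
  define W where "W = {r \<in> \<Theta>1 \<times> \<Theta>2. (case r of (c, d) \<Rightarrow> h1 c AND h2 d) = 1}"
  define Z1 where "Z1 = {c \<in> \<Theta>1. h1 c = 0}"
  define O1 where "O1 = {c \<in> \<Theta>1. h1 c = 1}"
  define Z2 where "Z2 = {d \<in> \<Theta>2. h2 d = 0}"
  define O2 where "O2 = {d \<in> \<Theta>2. h2 d = 1}"
  note sets = Z_def W_def Z1_def O1_def Z2_def O2_def
  note m1 = mc1[unfolded markov_chain_def] and m2 = mc2[unfolded markov_chain_def]
  have fin: "finite \<Theta>1" "finite \<Theta>2" "finite Z1" "finite O1" "finite Z2" "finite O2"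
    using m1 m2 by (auto simp: sets)
  have "(\<Sum>(c, d)\<in>Z. P1 a c t * P2 b d t) \<le> min (min (p0_1 + p1_1 * p0_2) (p0_2 + p1_2 * p0_1)) 1 \<and>
      (\<Sum>(c, d)\<in>W. P1 a c t * P2 b d t) \<le> p1_1 * p1_2"
    if ab: "a \<in> \<Theta>1" "b \<in> \<Theta>2" for a b t
  proof -
    \<comment> \<open>The probabilities of moving from \<open>a\<close>, respectively
      \<open>b\<close>, to a state with output 0 (\<open>z1\<close>, \<open>z2\<close>) or output 1
      (\<open>o1\<close>, \<open>o2\<close>).\<close>
    define z1 where "z1 = (\<Sum>c\<in>Z1. P1 a c t)"
    define o1 where "o1 = (\<Sum>c\<in>O1. P1 a c t)"
    define z2 where "z2 = (\<Sum>d\<in>Z2. P2 b d t)"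
    define o2 where "o2 = (\<Sum>d\<in>O2. P2 b d t)"
    note masses = z1_def o1_def z2_def o2_def
    have le: "z1 \<le> p0_1" "o1 \<le> p1_1" "z2 \<le> p0_2" "o2 \<le> p1_2"
      using b1 b2 ab by (auto simp: masses sets transition_bounds_def)
    have nonneg: "z1 \<ge> 0" "o1 \<ge> 0" "z2 \<ge> 0" "o2 \<ge> 0"
      using m1 m2 ab by (auto simp: masses sets intro!: sum_nonneg)
    \<comment> \<open>A bit is 0 or 1, so the two output levels partition each state set, and the
      rows are stochastic.\<close>
    have one: "z1 + o1 = 1" "z2 + o2 = 1"
    proof -
      have "\<Theta>1 = Z1 \<union> O1" "Z1 \<inter> O1 = {}" "\<Theta>2 = Z2 \<union> O2" "Z2 \<inter> O2 = {}"
        by (auto simp: sets)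
      then show "z1 + o1 = 1" "z2 + o2 = 1"
        using m1 m2 ab fin by (auto simp: masses simp flip: sum.union_disjoint)
    qed
    have box: "(\<Sum>(c, d)\<in>A \<times> B. P1 a c t * P2 b d t) = (\<Sum>c\<in>A. P1 a c t) * (\<Sum>d\<in>B. P2 b d t)" for A B
      by (simp add: sum_product sum.cartesian_product)
    have "W = O1 \<times> O2"
      by (auto simp: sets bit_and_eq_1_iff)
    then have W: "(\<Sum>(c, d)\<in>W. P1 a c t * P2 b d t) = o1 * o2"
      by (simp add: box masses)
    \<comment> \<open>Three disjoint boxes: \<open>Z1 \<times> Z2\<close> can be merged with either
      of the others, so a single formula for the mass serves both asymmetric bounds.\<close>
    have "Z = Z1 \<times> Z2 \<union> Z1 \<times> O2 \<union> O1 \<times> Z2"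
      by (auto simp: sets bit_and_eq_0_iff)
    moreover have "(Z1 \<times> Z2) \<inter> (Z1 \<times> O2) = {}" "(Z1 \<times> Z2 \<union> Z1 \<times> O2) \<inter> (O1 \<times> Z2) = {}"
      by (auto simp: sets)
    ultimately have Z: "(\<Sum>(c, d)\<in>Z. P1 a c t * P2 b d t) = z1 * z2 + z1 * o2 + o1 * z2"
      using fin by (simp add: sum.union_disjoint box masses)
    \<comment> \<open>By \<open>one\<close>, these two forms are \<open>z1 + o1 * z2\<close> and
      \<open>z2 + o2 * z1\<close>; the third form below is \<open>1 - o1 * o2\<close>, which gives
      the bound 1.\<close>
    have "z1 * z2 + z1 * o2 + o1 * z2 = z1 * (z2 + o2) + o1 * z2"
      "z1 * z2 + z1 * o2 + o1 * z2 = z2 * (z1 + o1) + o2 * z1"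
      by (simp_all add: algebra_simps)
    moreover have "z1 * z2 + z1 * o2 + o1 * z2 = (z1 + o1) * (z2 + o2) - o1 * o2"
      by (simp add: algebra_simps)
    \<comment> \<open>Monotonicity of the product uses that the masses and the bounds
      \<open>p1_1\<close>, \<open>p1_2\<close> are nonnegative.\<close>
    moreover have "o1 * z2 \<le> p1_1 * p0_2" "o2 * z1 \<le> p1_2 * p0_1" "o1 * o2 \<le> p1_1 * p1_2" "0 \<le> o1 * o2"
      using le nonneg p1 by (auto intro: mult_mono)
    ultimately show ?thesis
      using le one by (simp add: Z W)
  qed
  then show ?thesis
    unfolding transition_bounds_def Z_def W_def by (auto simp: case_prod_unfold)
qed

theorem theorem3p3:
  fixes M :: "'w measure" and F :: "nat \<Rightarrow> 'w measure"
    and \<Theta>1 :: "'a set" and \<nu>1 :: "'a \<Rightarrow> real" and P1 :: "'a \<Rightarrow> 'a \<Rightarrow> nat \<Rightarrow> real"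
    and \<theta>1 :: "nat \<Rightarrow> 'w \<Rightarrow> 'a" and h1 :: "'a \<Rightarrow> bit" and l1 :: "nat \<Rightarrow> 'w \<Rightarrow> bit"
    and \<Theta>2 :: "'b set" and \<nu>2 :: "'b \<Rightarrow> real" and P2 :: "'b \<Rightarrow> 'b \<Rightarrow> nat \<Rightarrow> real"
    and \<theta>2 :: "nat \<Rightarrow> 'w \<Rightarrow> 'b" and h2 :: "'b \<Rightarrow> bit" and l2 :: "nat \<Rightarrow> 'w \<Rightarrow> bit"
    and p0_1 p1_1 p0_2 p1_2 :: real
  assumes "prob_space M"
    and "filtration (space M) F" and "\<And>t. sets (F t) \<subseteq> sets M"
    and "p0_1 \<in> {0..1}" and "p1_1 \<in> {0..1}" and "p0_2 \<in> {0..1}" and "p1_2 \<in> {0..1}"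
    and "hidden_markov_model M F \<Theta>1 \<nu>1 P1 \<theta>1 h1 l1" and "transition_bounds \<Theta>1 P1 h1 p0_1 p1_1"
    and "hidden_markov_model M F \<Theta>2 \<nu>2 P2 \<theta>2 h2 l2" and "transition_bounds \<Theta>2 P2 h2 p0_2 p1_2"
    and "indep_processes M \<theta>1 \<theta>2"
  defines "pt0 \<equiv> min (min (p0_1 + p1_1 * p0_2) (p0_2 + p1_2 * p0_1)) 1"
    and "pt1 \<equiv> p1_1 * p1_2"
    and "lt \<equiv> (\<lambda>t \<omega>. l1 t \<omega> AND l2 t \<omega>)"
  shows "hmm_output_process M F lt \<and> lt \<in> hmm_class M F pt0 pt1"
proof -
  have sp: "space (F t) = space M" for t
    using \<open>filtration (space M) F\<close> by (simp add: filtration_def)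
  have hmm: "hidden_markov_model M F (\<Theta>1 \<times> \<Theta>2) (\<lambda>(a, b). \<nu>1 a * \<nu>2 b)
      (\<lambda>(a, b) (c, d) t. P1 a c t * P2 b d t) (\<lambda>t \<omega>. (\<theta>1 t \<omega>, \<theta>2 t \<omega>))
      (\<lambda>(a, b). h1 a AND h2 b) lt"
    unfolding lt_def by (rule hidden_markov_model_and) fact+
  have bounds: "transition_bounds (\<Theta>1 \<times> \<Theta>2) (\<lambda>(a, b) (c, d) t. P1 a c t * P2 b d t)
      (\<lambda>(a, b). h1 a AND h2 b) pt0 pt1"
    unfolding pt0_def pt1_def
    using assms(5,7-11) by (intro transition_bounds_and) (auto simp: hidden_markov_model_def)
  \<comment> \<open>The model found has states in \<open>\<Theta>1 \<times> \<Theta>2\<close>,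
    whereas the class quantifies over sets of natural numbers. The two introduction rules relabel
    the states injectively; \<open>sp\<close> ensures that the chain stays in its state set on all
    of \<open>space M\<close>.\<close>
  show ?thesis
    using hmm_output_processI[OF hmm sp] hmm_classI[OF hmm bounds sp] by blast
qed

end
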